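(* Let $f=\{f_i\}_{i\in[k]}$ and $g=\{g_j\}_{j\in[l]}$ be finite families of polynomials in $\mathbf{R}[x]=\mathbf{R}[x_1,\ldots,x_n]$, and let $P(f)$, $Z(g)$, $C(f)$, $I(g)$ be the associated sets defined in the context. Suppose $r>0$ and $\|x\|_\infty<r$ for every $x\in P(f)\cap Z(g)$. Then the following are equivalent: (a) $P(f)\cap Z(g)=\emptyset$. (b) There exists $h(x)=\sum_\alpha c_\alpha x^\alpha\in 1+C(f)+I(g)$ such that $$\max_\alpha|c_\alpha|\leq\Bigg[\sum_{k=0}^{\deg h(x)}\binom{n+k-1}{k}r^k\Bigg]^{-1}.$$
   Context: $[k]=\{1,\ldots,k\}$, and $\Sigma^2[x]$ is the set of polynomials in $\mathbf{R}[x]$ that can be expressed as a sum of squares of polynomials from $\mathbf{R}[x]$. Define $$P(f):=\{x\in\mathbf{R}^n: f_i(x)\ge 0\ \forall i\in[k]\},\qquad Z(g):=\{x\in\mathbf{R}^n: g_j(x)=0\ \forall j\in[l]\},$$ $$C(f):=\Big\{\sum_{I\subseteq[k]}s_I(x)\prod_{i\in I}f_i(x): s_I(x)\in\Sigma^2[x]\ \forall I\subseteq[k]\Big\},$$ $$I(g):=\Big\{\sum_{j\in[l]}t_j(x)g_j(x): t_j(x)\in\mathbf{R}[x]\ \forall j\in[l]\Big\},$$ with empty products equal to $1$. The set $1+C(f)+I(g)$ is $\{1+p+q: p\in C(f),\ q\in I(g)\}$. In $h(x)=\sum_\alpha c_\alpha x^\alpha$, the sum is over multi-indices $\alpha$ and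 $c_\alpha$ are the real coefficients of $h$. The zero polynomial $h=0$ is allowed and is regarded as satisfying the coefficient bound (e.g. with the convention $\deg 0=0$). The summation index $k$ in the coefficient bound is a dummy variable, unrelated to the number of polynomials $f_i$.
   Formalization: In (b) the polynomial h is additionally required to differ from the constant 1, since h = 1 always lies in 1+C(f)+I(g) and meets the bound with equality, which makes the equivalence as written false (e.g. n = 1, no f, g = x, r = 1). *)

theory Defs
  imports "HOL-Analysis.Analysis" "HOL-Library.Poly_Mapping"
begin

(* A polynomial in R[x_i : i in 'n], with CARD('n) variables: a finitely supported map from
   exponent vectors to coefficients.  The ring operations are those of Poly_Mapping. *)
type_synonym 'n mpoly = "('n \<Rightarrow>\<^sub>0 nat) \<Rightarrow>\<^sub>0 real"

definition mpoly_eval :: "'n::finite mpoly \<Rightarrow> real ^ 'n \<Rightarrow> real" where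
  "mpoly_eval p x =
     (\<Sum>\<alpha>\<in>Poly_Mapping.keys p. Poly_Mapping.lookup p \<alpha> * (\<Prod>i\<in>UNIV. (x $ i) ^ Poly_Mapping.lookup \<alpha> i))"

(* Total degree; the zero polynomial has degree 0. *)
definition mpoly_degree :: "'n::finite mpoly \<Rightarrow> nat" where
  "mpoly_degree p =
     Max (insert 0 ((\<lambda>\<alpha>. \<Sum>i\<in>UNIV. Poly_Mapping.lookup \<alpha> i) ` Poly_Mapping.keys p))"

(* The set of values is finite because all but finitely many coefficients are 0. *)
definition max_abs_coeff :: "'n::finite mpoly \<Rightarrow> real" where
  "max_abs_coeff p = Max (range (\<lambda>\<alpha>. \<bar>Poly_Mapping.lookup p \<alpha>\<bar>))"

definition sos :: "'n::finite mpoly set" where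
  "sos = {p. \<exists>(m::nat) q. p = (\<Sum>j<m. (q j)\<^sup>2)}"

(* A family indexed by {1..k} is a function on nat of which only the values on {1..k} are used. *)
definition nonneg_set :: "nat \<Rightarrow> (nat \<Rightarrow> 'n::finite mpoly) \<Rightarrow> (real ^ 'n) set" where
  "nonneg_set k f = {x. \<forall>i\<in>{1..k}. mpoly_eval (f i) x \<ge> 0}"

definition zero_set :: "nat \<Rightarrow> (nat \<Rightarrow> 'n::finite mpoly) \<Rightarrow> (real ^ 'n) set" where
  "zero_set l g = {x. \<forall>j\<in>{1..l}. mpoly_eval (g j) x = 0}"

definition gen_cone :: "nat \<Rightarrow> (nat \<Rightarrow> 'n::finite mpoly) \<Rightarrow> 'n mpoly set" where
  "gen_cone k f = {(\<Sum>I\<in>Pow {1..k}. s I * (\<Prod>i\<in>I. f i)) | s. \<forall>I\<in>Pow {1..k}. s I \<in> sos}"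

definition gen_ideal :: "nat \<Rightarrow> (nat \<Rightarrow> 'n::finite mpoly) \<Rightarrow> 'n mpoly set" where
  "gen_ideal l g = {(\<Sum>j\<in>{1..l}. t j * g j) | t. True}"

definition one_plus_cone_ideal ::
    "nat \<Rightarrow> (nat \<Rightarrow> 'n::finite mpoly) \<Rightarrow> nat \<Rightarrow> (nat \<Rightarrow> 'n mpoly) \<Rightarrow> 'n mpoly set" where
  "one_plus_cone_ideal k f l g = {1 + p + q | p q. p \<in> gen_cone k f \<and> q \<in> gen_ideal l g}"

(* The constant polynomial 1 always lies in 1 + C(f) + I(g) and meets the non-strict coefficient
   bound with equality, whether or not the semialgebraic set is empty.  It certifies nothing, so a
   certificate has to be required to differ from 1. *)
lemma one_meets_bound:
  fixes f g :: "nat \<Rightarrow> 'n::finite mpoly"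
    and r :: real
  shows "(1 :: 'n mpoly) \<in> one_plus_cone_ideal k f l g"
    and "max_abs_coeff (1 :: 'n mpoly)
      \<le> inverse (\<Sum>m=0..mpoly_degree (1 :: 'n mpoly). real ((CARD('n) + m - 1) choose m) * r ^ m)"
proof -
  have "(0::'n mpoly) \<in> sos"
    unfolding sos_def by (auto intro!: exI[of _ "0::nat"])
  then have c: "(0::'n mpoly) \<in> gen_cone k f"
    unfolding gen_cone_def by (auto intro!: exI[of _ "\<lambda>_. 0"])
  have i: "(0::'n mpoly) \<in> gen_ideal l g"
    unfolding gen_ideal_def by (auto intro!: exI[of _ "\<lambda>_. 0"])
  show "(1 :: 'n mpoly) \<in> one_plus_cone_ideal k f l g"
    unfolding one_plus_cone_ideal_def using c i
    by (auto intro!: exI[of _ "0::'n mpoly"])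
  have d: "mpoly_degree (1 :: 'n mpoly) = 0"
    by (simp add: mpoly_degree_def)
  have "range (\<lambda>\<alpha>. \<bar>Poly_Mapping.lookup (1 :: 'n mpoly) \<alpha>\<bar>) = {1, 0}"
  proof -
    have "\<exists>\<alpha>::'n \<Rightarrow>\<^sub>0 nat. \<alpha> \<noteq> 0"
      by (intro exI[of _ "Poly_Mapping.single undefined 1"]) (metis lookup_single_eq lookup_zero zero_neq_one)
    then show ?thesis
      by (auto simp: lookup_one when_def image_def)
  qed
  then have "max_abs_coeff (1 :: 'n mpoly) = 1"
    by (simp add: max_abs_coeff_def)
  then show "max_abs_coeff (1 :: 'n mpoly)
      \<le> inverse (\<Sum>m=0..mpoly_degree (1 :: 'n mpoly). real ((CARD('n) + m - 1) choose m) * r ^ m)"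
    by (simp add: d)
qed

end

theory Submission
  imports Defs
begin

text \<open>If \<open>x\<close> lies in \<open>P(f) \<inter> Z(g)\<close>, then every \<open>h\<close> in \<open>1 + C(f) + I(g)\<close> satisfies \<open>h(x) \<ge> 1\<close>.
  There are \<open>n + m - 1\<close> choose \<open>m\<close> monomials of degree \<open>m\<close>, and each has absolute value at most
  \<open>\<parallel>x\<parallel>\<^sup>m\<close> (sup norm), so the coefficient bound together with \<open>\<parallel>x\<parallel> < r\<close> forces
  \<open>h(x) < 1\<close> as soon as \<open>h\<close> has positive degree; a constant
  \<open>h \<ge> 1\<close> obeying the bound can only be \<open>1\<close>.
  This contradiction gives one direction (\<open>small_certificate_imp_empty\<close>).

  For the converse, the Krivine-Stengle Positivstellensatz would yield the certificate \<open>h = 0\<close>. A small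
  \<open>h\<close> suffices, and for that the compact case of the Positivstellensatz is enough. Adjoin to
  the cone the polynomial \<open>\<rho> - |x|\<^sup>2\<close>, whose positivity describes a ball, with \<open>\<rho>\<close> to be chosen large.
  The resulting preordering is archimedean: every polynomial is bounded by a constant. An
  archimedean preordering without \<open>-1\<close> is nonnegative at some point: Zorn's lemma extends it to a
  total one, and rounding each polynomial to the real number it is infinitesimally close to is a ring
  homomorphism to the reals, that is, evaluation at a point. As \<open>P(f) \<inter> Z(g)\<close> is empty, \<open>-1\<close> must therefore belong to the preordering, and with
  \<open>y = |x|\<^sup>2 / \<rho>\<close> this reads, after rescaling a multiplier,
  \<open>-1 = a + (1 - y) b + q\<close> where \<open>a, b \<in> C(f)\<close> and \<open>q \<in> I(g)\<close> (\<open>empty_system_ball_certificate\<close>).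

  The factor \<open>1 - y\<close> need not lie in the cone, but
  \<open>(1 - y) (1 - y\<^sup>m) = (1 - y)\<^sup>2 (1 + y + \<dots> + y\<^bsup>m-1\<^esup>)\<close> does, for every \<open>m\<close>. Replacing the
  former by the latter costs only \<open>y\<^sup>m (1 - y) b\<close>: the polynomial
  \<open>1 + a + (1 - y) (1 - y\<^sup>m) b + q\<close> lies in \<open>1 + C(f) + I(g)\<close> and equals
  \<open>y\<^sup>m (y - 1) b\<close> (\<open>empty_imp_certificate_family\<close>). Its coefficients decay like
  \<open>(n / \<rho>)\<^sup>m\<close>, whereas the bound to be met decays at most like \<open>(2 r + 1)\<^bsup>-2m\<^esup>\<close>; so a large \<open>m\<close>
  works once \<open>\<rho> > n (2 r + 1)\<^sup>2\<close> (\<open>power_multiple_small\<close>).\<close>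

section \<open>Preorderings of commutative rings\<close>

definition preordering :: "'a::comm_ring_1 set \<Rightarrow> bool" where
  "preordering T \<longleftrightarrow> (\<forall>a. a\<^sup>2 \<in> T) \<and> (\<forall>a\<in>T. \<forall>b\<in>T. a + b \<in> T \<and> a * b \<in> T)"

lemma preorderingD:
  assumes "preordering T"
  shows preordering_square: "a\<^sup>2 \<in> T"
    and preordering_add: "a \<in> T \<Longrightarrow> b \<in> T \<Longrightarrow> a + b \<in> T"
    and preordering_mult: "a \<in> T \<Longrightarrow> b \<in> T \<Longrightarrow> a * b \<in> T"
    and preordering_zero: "0 \<in> T"
    and preordering_one: "1 \<in> T"
  using assms unfolding preordering_def by (auto dest: spec[of _ 0] spec[of _ 1])

lemma preordering_sum:
  assumes "preordering T" "\<And>i. i \<in> A \<Longrightarrow> f i \<in> T"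
  shows "sum f A \<in> T"
  using assms(2) by (induction A rule: infinite_finite_induct)
    (auto intro: preordering_zero preordering_add assms(1))

lemma preordering_power:
  assumes "preordering T" "a \<in> T"
  shows "a ^ n \<in> T"
  by (induction n) (auto intro: preordering_one preordering_mult assms)

text \<open>For a preordering \<open>T\<close> this is the smallest preordering containing \<open>T\<close> and \<open>a\<close>.\<close>

definition adjoin :: "'a::comm_ring_1 \<Rightarrow> 'a set \<Rightarrow> 'a set" where
  "adjoin a T = {s + a * t | s t. s \<in> T \<and> t \<in> T}"

lemma adjoinI: "s \<in> T \<Longrightarrow> t \<in> T \<Longrightarrow> s + a * t \<in> adjoin a T"
  unfolding adjoin_def by blast

lemma subset_adjoin:
  assumes "preordering T"
  shows "T \<subseteq> adjoin a T"
  using adjoinI[OF _ preordering_zero[OF assms], of _ a] by auto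

lemma generator_in_adjoin:
  assumes "preordering T"
  shows "a \<in> adjoin a T"
  using adjoinI[OF preordering_zero[OF assms] preordering_one[OF assms], of a] by simp

lemma preordering_adjoin:
  assumes T: "preordering T"
  shows "preordering (adjoin a T)"
  unfolding preordering_def
proof (intro conjI ballI allI)
  fix b show "b\<^sup>2 \<in> adjoin a T"
    using subset_adjoin[OF T] preordering_square[OF T] by blast
next
  fix b c assume "b \<in> adjoin a T" "c \<in> adjoin a T"
  then obtain s t s' t' where b: "b = s + a * t" "c = s' + a * t'"
    and m: "s \<in> T" "t \<in> T" "s' \<in> T" "t' \<in> T"
    unfolding adjoin_def by blast
  have "b + c = (s + s') + a * (t + t')"
    by (simp add: b algebra_simps)
  then show "b + c \<in> adjoin a T"
    using m by (auto intro!: adjoinI preordering_add[OF T])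
  \<comment> \<open>The cross term with \<open>a\<^sup>2\<close> is absorbed because squares lie in \<open>T\<close>.\<close>
  have "b * c = (s * s' + a\<^sup>2 * (t * t')) + a * (s * t' + t * s')"
    by (simp add: b algebra_simps power2_eq_square)
  then show "b * c \<in> adjoin a T"
    using m by (auto intro!: adjoinI preordering_add[OF T] preordering_mult[OF T]
        preordering_square[OF T])
qed

text \<open>Expanding \<open>(s + j) (s' + j')\<close>, every term other than \<open>s s'\<close> falls into the ideal.\<close>

lemma preordering_plus_ideal:
  assumes T: "preordering T"
    and J: "0 \<in> J" "\<And>a b. a \<in> J \<Longrightarrow> b \<in> J \<Longrightarrow> a + b \<in> J" "\<And>a b. a \<in> J \<Longrightarrow> b * a \<in> J"
  shows "preordering {s + j | s j. s \<in> T \<and> j \<in> J}" (is "preordering ?U")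
  unfolding preordering_def
proof (intro conjI ballI allI)
  fix b show "b\<^sup>2 \<in> ?U"
    using preordering_square[OF T, of b] J(1) by force
next
  fix b c assume "b \<in> ?U" "c \<in> ?U"
  then obtain s j s' j' where b: "b = s + j" "c = s' + j'"
    and m: "s \<in> T" "j \<in> J" "s' \<in> T" "j' \<in> J"
    by blast
  have "b + c = (s + s') + (j + j')"
    by (simp add: b)
  moreover have "s + s' \<in> T" "j + j' \<in> J"
    using m by (auto intro: J preordering_add[OF T])
  ultimately show "b + c \<in> ?U"
    by blast
  have "b * c = s * s' + (s * j' + (s' * j + j * j'))"
    by (simp add: b algebra_simps)
  moreover have "s * s' \<in> T" "s * j' + (s' * j + j * j') \<in> J"
    using m by (auto intro: J preordering_mult[OF T])
  ultimately show "b * c \<in> ?U"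
    by blast
qed

text \<open>A preordering that is maximal among those omitting \<open>-1\<close> is total: if neither \<open>a\<close> nor \<open>-a\<close>
  belonged to it, adjoining either one would produce \<open>-1\<close>, and multiplying the two resulting
  identities produces \<open>-1\<close> inside the preordering itself.\<close>

lemma preordering_extends_to_total:
  assumes "preordering T" "-1 \<notin> T"
  obtains Q where "T \<subseteq> Q" "preordering Q" "-1 \<notin> Q" "\<And>a. a \<in> Q \<or> -a \<in> Q"
proof -
  let ?F = "{Q. T \<subseteq> Q \<and> preordering Q \<and> -1 \<notin> Q}"
  have "\<exists>M\<in>?F. \<forall>X\<in>?F. M \<subseteq> X \<longrightarrow> X = M"
  proof (rule subset_Zorn_nonempty)
    show "?F \<noteq> {}" using assms by blast
  next
    fix C assume C: "C \<noteq> {}" "subset.chain ?F C"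
    then have CF: "C \<subseteq> ?F" and ch: "\<And>X Y. X \<in> C \<Longrightarrow> Y \<in> C \<Longrightarrow> X \<subseteq> Y \<or> Y \<subseteq> X"
      unfolding subset.chain_def by (auto simp: subset_chain_def)
    have "preordering (\<Union>C)"
      unfolding preordering_def
    proof (intro conjI ballI allI)
      fix a show "a\<^sup>2 \<in> \<Union>C"
        using C(1) CF preordering_square by blast
    next
      fix a b assume "a \<in> \<Union>C" "b \<in> \<Union>C"
      then obtain X where X: "X \<in> C" "a \<in> X" "b \<in> X"
        using ch by blast
      moreover have "preordering X"
        using X CF by blast
      ultimately show "a + b \<in> \<Union>C" "a * b \<in> \<Union>C"
        using preordering_add preordering_mult by blast+
    qed
    moreover obtain X where "X \<in> C"
      using C(1) by blast
    ultimately show "\<Union>C \<in> ?F"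
      using CF by auto
  qed
  then obtain Q where "Q \<in> ?F" and max: "\<And>X. X \<in> ?F \<Longrightarrow> Q \<subseteq> X \<Longrightarrow> X = Q"
    by (elim bexE) (rule that, assumption, simp)
  then have Q: "T \<subseteq> Q" "preordering Q" "-1 \<notin> Q"
    by simp_all
  have adj: "-1 \<in> adjoin a Q" if "a \<notin> Q" for a
  proof (rule ccontr)
    assume "-1 \<notin> adjoin a Q"
    then have "adjoin a Q = Q"
      using Q(1) subset_adjoin[OF Q(2), of a] preordering_adjoin[OF Q(2), of a]
      by (intro max) auto
    then show False
      using generator_in_adjoin[OF Q(2), of a] that by simp
  qed
  have "a \<in> Q \<or> -a \<in> Q" for a
  proof (rule ccontr)
    assume "\<not> (a \<in> Q \<or> -a \<in> Q)"
    then obtain s t s' t' where e: "-1 = s + a * t" "-1 = s' + (-a) * t'"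
      and m: "s \<in> Q" "t \<in> Q" "s' \<in> Q" "t' \<in> Q"
      using adj[of a] adj[of "-a"] unfolding adjoin_def by blast
    have "a * t = - 1 - s"
      unfolding e(1) by simp
    moreover have "1 + s' = a * t' + (1 + (s' + (- a) * t'))"
      by simp
    then have "a * t' = 1 + s'"
      unfolding e(2)[symmetric] by simp
    ultimately have h: "a * t = - 1 - s" "a * t' = 1 + s'"
      by auto
    have "a\<^sup>2 * (t * t') = (a * t) * (a * t')"
      by (simp add: power2_eq_square algebra_simps)
    also have "\<dots> = - 1 - s - s' - s * s'"
      unfolding h by (simp add: algebra_simps)
    finally have "-1 = s + s' + s * s' + a\<^sup>2 * (t * t')"
      by (simp add: algebra_simps)
    moreover have "s + s' + s * s' + a\<^sup>2 * (t * t') \<in> Q"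
      using m by (intro preordering_add[OF Q(2)] preordering_mult[OF Q(2)]
          preordering_square[OF Q(2)])
    ultimately show False
      using Q(3) by simp
  qed
  with Q that show thesis by blast
qed

section \<open>Archimedean preorderings and real characters\<close>

text \<open>A commutative ring together with a copy of the real numbers; \<open>\<kappa>\<close> plays the role of the
  inclusion of constants.\<close>

locale ring_over_reals =
  fixes \<kappa> :: "real \<Rightarrow> 'a::comm_ring_1"
  assumes \<kappa>_one: "\<kappa> 1 = 1"
    and \<kappa>_add: "\<kappa> (a + b) = \<kappa> a + \<kappa> b"
    and \<kappa>_mult: "\<kappa> (a * b) = \<kappa> a * \<kappa> b"
begin

lemma \<kappa>_zero: "\<kappa> 0 = 0"
  using \<kappa>_add[of 0 0] by simp

lemma \<kappa>_minus: "\<kappa> (- a) = - \<kappa> a"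
  using \<kappa>_add[of a "- a"] by (simp add: \<kappa>_zero eq_neg_iff_add_eq_0 add.commute)

lemma \<kappa>_diff: "\<kappa> (a - b) = \<kappa> a - \<kappa> b"
  using \<kappa>_add[of a "- b"] by (simp add: \<kappa>_minus)

lemma \<kappa>_half: "\<kappa> (1/2) * (p + p) = p"
proof -
  have "\<kappa> (1/2) * (p + p) = (\<kappa> (1/2) + \<kappa> (1/2)) * p"
    by (simp add: algebra_simps)
  then show ?thesis
    by (simp flip: \<kappa>_add add: \<kappa>_one)
qed

lemma nonneg_const_in_preordering:
  assumes "preordering T" "c \<ge> 0"
  shows "\<kappa> c \<in> T"
proof -
  have "\<kappa> c = (\<kappa> (sqrt c))\<^sup>2"
    using assms(2) by (simp add: power2_eq_square flip: \<kappa>_mult)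
  then show ?thesis
    using preordering_square[OF assms(1)] by metis
qed

lemma half_in_preordering:
  fixes p :: 'a
  assumes "preordering T" "p + p \<in> T"
  shows "p \<in> T"
  using preordering_mult[OF assms(1) nonneg_const_in_preordering[OF assms(1), of "1/2"] assms(2)]
  by (simp only: \<kappa>_half)

definition bounded_by :: "'a set \<Rightarrow> real \<Rightarrow> 'a \<Rightarrow> bool" where
  "bounded_by T M p \<longleftrightarrow> \<kappa> M - p \<in> T \<and> \<kappa> M + p \<in> T"

lemma bounded_by_const:
  assumes "preordering T"
  shows "bounded_by T \<bar>c\<bar> (\<kappa> c)"
  using nonneg_const_in_preordering[OF assms, of "\<bar>c\<bar> - c"]
    nonneg_const_in_preordering[OF assms, of "\<bar>c\<bar> + c"]
  by (simp add: bounded_by_def \<kappa>_diff \<kappa>_add)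

lemma bounded_by_add:
  assumes "preordering T" "bounded_by T M p" "bounded_by T N q"
  shows "bounded_by T (M + N) (p + q)"
proof -
  have "\<kappa> (M + N) - (p + q) = (\<kappa> M - p) + (\<kappa> N - q)"
    "\<kappa> (M + N) + (p + q) = (\<kappa> M + p) + (\<kappa> N + q)"
    by (simp_all add: \<kappa>_add)
  then show ?thesis
    using assms preordering_add[OF assms(1)] unfolding bounded_by_def by metis
qed

lemma bounded_by_minus: "bounded_by T M (- p) \<longleftrightarrow> bounded_by T M p"
  by (auto simp: bounded_by_def)

lemma bounded_by_mono:
  assumes "preordering T" "bounded_by T M p" "M \<le> N"
  shows "bounded_by T N p"
proof -
  have "bounded_by T (N - M) 0"
    using nonneg_const_in_preordering[OF assms(1), of "N - M"] assms(3)
    by (simp add: bounded_by_def)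
  from bounded_by_add[OF assms(1,2) this] show ?thesis by simp
qed

text \<open>Products of bounds come from \<open>2 (M N - p q) = (M - p) (N + q) + (M + p) (N - q)\<close> and the
  same identity with \<open>- q\<close> for \<open>q\<close>.\<close>

lemma bounded_by_mult:
  assumes T: "preordering T" and b: "bounded_by T M p" "bounded_by T N q"
  shows "bounded_by T (M * N) (p * q)"
  unfolding bounded_by_def
proof (intro conjI; rule half_in_preordering[OF T])
  note mem = b[unfolded bounded_by_def]
  have "(\<kappa> (M * N) - p * q) + (\<kappa> (M * N) - p * q) = 
    (\<kappa> M - p) * (\<kappa> N + q) + (\<kappa> M + p) * (\<kappa> N - q)"
    by (simp add: \<kappa>_mult algebra_simps)
  also have "\<dots> \<in> T"
    using mem by (auto intro!: preordering_add[OF T preordering_mult[OF T] preordering_mult[OF T]])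
  finally show "(\<kappa> (M * N) - p * q) + (\<kappa> (M * N) - p * q) \<in> T" .
  have "(\<kappa> (M * N) + p * q) + (\<kappa> (M * N) + p * q) = 
    (\<kappa> M - p) * (\<kappa> N - q) + (\<kappa> M + p) * (\<kappa> N + q)"
    by (simp add: \<kappa>_mult algebra_simps)
  also have "\<dots> \<in> T"
    using mem by (auto intro!: preordering_add[OF T preordering_mult[OF T] preordering_mult[OF T]])
  finally show "(\<kappa> (M * N) + p * q) + (\<kappa> (M * N) + p * q) \<in> T" .
qed

text \<open>A bound on a square bounds the element, because
  \<open>(M + 1) \<plusminus> 2 p = (M - p\<^sup>2) + (1 \<plusminus> p)\<^sup>2\<close>.\<close>

lemma bounded_by_if_square_le:
  assumes T: "preordering T" and sq: "\<kappa> M - p\<^sup>2 \<in> T"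
  shows "bounded_by T ((M + 1) / 2) p"
  unfolding bounded_by_def
proof (intro conjI; rule half_in_preordering[OF T])
  have e: "\<kappa> ((M + 1) / 2) + \<kappa> ((M + 1) / 2) = \<kappa> M + 1"
    by (simp flip: \<kappa>_add \<kappa>_one)
  have "(\<kappa> ((M + 1) / 2) - p) + (\<kappa> ((M + 1) / 2) - p)
      = (\<kappa> ((M + 1) / 2) + \<kappa> ((M + 1) / 2)) - p - p"
    by (simp add: algebra_simps)
  also have "\<dots> = (\<kappa> M - p\<^sup>2) + (1 - p)\<^sup>2"
    unfolding e by (simp add: algebra_simps power2_eq_square)
  also have "\<dots> \<in> T"
    by (intro preordering_add[OF T] preordering_square[OF T] sq)
  finally show "(\<kappa> ((M + 1) / 2) - p) + (\<kappa> ((M + 1) / 2) - p) \<in> T" .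
  have "(\<kappa> ((M + 1) / 2) + p) + (\<kappa> ((M + 1) / 2) + p)
      = (\<kappa> ((M + 1) / 2) + \<kappa> ((M + 1) / 2)) + p + p"
    by (simp add: algebra_simps)
  also have "\<dots> = (\<kappa> M - p\<^sup>2) + (1 + p)\<^sup>2"
    unfolding e by (simp add: algebra_simps power2_eq_square)
  also have "\<dots> \<in> T"
    by (intro preordering_add[OF T] preordering_square[OF T] sq)
  finally show "(\<kappa> ((M + 1) / 2) + p) + (\<kappa> ((M + 1) / 2) + p) \<in> T" .
qed

text \<open>Call an element infinitesimal if it is bounded by every positive real. When everything is
  bounded, the infinitesimals form an ideal, and for a total preordering a Dedekind cut places
  every element infinitesimally close to exactly one real number. The character is the
  resulting standard part.\<close>

lemma total_archimedean_character:
  assumes Q: "preordering Q" "-1 \<notin> Q" and total: "\<And>p. p \<in> Q \<or> - p \<in> Q"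
    and arch: "\<And>p. \<exists>M. bounded_by Q M p"
  obtains \<phi> :: "'a \<Rightarrow> real" where "\<And>p q. \<phi> (p + q) = \<phi> p + \<phi> q" "\<And>p q. \<phi> (p * q) = \<phi> p * \<phi> q"
    "\<And>c. \<phi> (\<kappa> c) = c" "\<And>p. p \<in> Q \<Longrightarrow> \<phi> p \<ge> 0"
proof -
  \<comment> \<open>A negative constant in \<open>Q\<close>, rescaled by a positive one, would be \<open>-1\<close>.\<close>
  have neg_const: "c \<ge> 0" if "\<kappa> c \<in> Q" for c
  proof (rule ccontr)
    assume "\<not> c \<ge> 0"
    then have "\<kappa> (-1) = \<kappa> c * \<kappa> (- 1 / c)" "\<kappa> (- 1 / c) \<in> Q"
      using nonneg_const_in_preordering[OF Q(1), of "- 1 / c"] by (simp_all flip: \<kappa>_mult add: field_simps)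
    then show False
      using that Q(2) preordering_mult[OF Q(1)] by (metis \<kappa>_minus \<kappa>_one)
  qed
  define inf where "inf p \<longleftrightarrow> (\<forall>e>0. bounded_by Q e p)" for p
  have inf_add: "inf (p + q)" if "inf p" "inf q" for p q
    unfolding inf_def
  proof (intro allI impI)
    fix e :: real assume "e > 0"
    then show "bounded_by Q e (p + q)"
      using bounded_by_add[OF Q(1), of "e/2" p "e/2" q] that unfolding inf_def by simp
  qed
  have inf_minus: "inf (- p)" if "inf p" for p
    using that unfolding inf_def bounded_by_minus .
  have inf_mult: "inf (p * q)" if "inf p" for p q
    unfolding inf_def
  proof (intro allI impI)
    fix e :: real assume e: "e > 0"
    obtain M where M: "bounded_by Q M q" using arch by blast
    then have M': "bounded_by Q (\<bar>M\<bar> + 1) q"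
      by (rule bounded_by_mono[OF Q(1)]) simp
    have "bounded_by Q (e / (\<bar>M\<bar> + 1)) p"
      using that e unfolding inf_def by simp
    then have "bounded_by Q (e / (\<bar>M\<bar> + 1) * (\<bar>M\<bar> + 1)) (p * q)"
      using M' by (rule bounded_by_mult[OF Q(1)])
    moreover have "\<bar>M\<bar> + 1 \<noteq> 0" by linarith
    ultimately show "bounded_by Q e (p * q)"
      by simp
  qed
  have inf_const: "c = 0" if "inf (\<kappa> c)" for c
  proof (rule ccontr)
    assume "c \<noteq> 0"
    then have "bounded_by Q (\<bar>c\<bar> / 2) (\<kappa> c)"
      using that unfolding inf_def by simp
    then have "\<bar>c\<bar> / 2 - c \<ge> 0" "\<bar>c\<bar> / 2 + c \<ge> 0"
      by (auto simp: bounded_by_def simp flip: \<kappa>_diff \<kappa>_add dest: neg_const)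
    with \<open>c \<noteq> 0\<close> show False by linarith
  qed
  \<comment> \<open>The Dedekind cut of \<open>p\<close>: below its supremum by definition, above it by totality.\<close>
  have ex: "\<exists>c. inf (p - \<kappa> c)" for p
  proof -
    obtain M where M: "bounded_by Q M p" using arch by blast
    define S where "S = {a. p - \<kappa> a \<in> Q}"
    have "-M \<in> S"
      using M by (simp add: S_def bounded_by_def \<kappa>_minus add.commute)
    have "a \<le> M" if "a \<in> S" for a
    proof -
      have "(p - \<kappa> a) + (\<kappa> M - p) \<in> Q"
        using that M preordering_add[OF Q(1)] unfolding S_def bounded_by_def by blast
      then show ?thesis
        using neg_const[of "M - a"] by (simp add: \<kappa>_diff)
    qed
    then have bdd: "bdd_above S" by (rule bdd_aboveI)
    have "bounded_by Q e (p - \<kappa> (Sup S))" if "e > 0" for e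
    proof -
      obtain a where a: "a \<in> S" "a > Sup S - e"
        using less_cSupD[of S "Sup S - e"] \<open>-M \<in> S\<close> \<open>e > 0\<close> by auto
      have "\<kappa> e + (p - \<kappa> (Sup S)) = (p - \<kappa> a) + \<kappa> (a - (Sup S - e))"
        by (simp add: \<kappa>_diff)
      also have "\<dots> \<in> Q"
        using a nonneg_const_in_preordering[OF Q(1), of "a - (Sup S - e)"]
        by (auto simp: S_def intro: preordering_add[OF Q(1)])
      finally have 1: "\<kappa> e + (p - \<kappa> (Sup S)) \<in> Q" .
      have "Sup S + e \<notin> S"
        using cSup_upper[OF _ bdd, of "Sup S + e"] \<open>e > 0\<close> by auto
      then have "- (p - \<kappa> (Sup S + e)) \<in> Q"
        using total unfolding S_def by blast
      then have "\<kappa> e - (p - \<kappa> (Sup S)) \<in> Q"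
        by (simp add: \<kappa>_add algebra_simps)
      with 1 show ?thesis by (simp add: bounded_by_def)
    qed
    then show ?thesis unfolding inf_def by blast
  qed
  then obtain \<phi> where \<phi>: "\<And>p. inf (p - \<kappa> (\<phi> p))" by metis
  \<comment> \<open>Uniqueness of the standard part reduces every algebraic law of \<open>\<phi>\<close> to exhibiting a suitable
    infinitesimal difference.\<close>
  have uniq: "\<phi> p = c" if "inf (p - \<kappa> c)" for p c
  proof -
    have "inf ((p - \<kappa> c) + - (p - \<kappa> (\<phi> p)))"
      by (intro inf_add inf_minus that \<phi>)
    then have "inf (\<kappa> (\<phi> p - c))"
      by (simp add: \<kappa>_diff)
    then show ?thesis using inf_const by force
  qed
  show thesis
  proof
    show "\<phi> (p + q) = \<phi> p + \<phi> q" for p q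
      using inf_add[OF \<phi>[of p] \<phi>[of q]] by (intro uniq) (simp add: \<kappa>_add algebra_simps)
    show "\<phi> (p * q) = \<phi> p * \<phi> q" for p q
    proof (rule uniq)
      have "inf ((p - \<kappa> (\<phi> p)) * q + (q - \<kappa> (\<phi> q)) * \<kappa> (\<phi> p))"
        by (intro inf_add inf_mult \<phi>)
      then show "inf (p * q - \<kappa> (\<phi> p * \<phi> q))"
        by (simp add: \<kappa>_mult algebra_simps)
    qed
    show "\<phi> (\<kappa> c) = c" for c
      using bounded_by_const[OF Q(1), of 0] bounded_by_mono[OF Q(1), of 0]
      by (intro uniq) (auto simp: inf_def \<kappa>_zero)
    show "\<phi> p \<ge> 0" if "p \<in> Q" for p
    proof (rule ccontr)
      assume "\<not> \<phi> p \<ge> 0"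
      then have "bounded_by Q (- \<phi> p / 2) (p - \<kappa> (\<phi> p))"
        using \<phi>[of p] unfolding inf_def by simp
      then have "p + (\<kappa> (- \<phi> p / 2) - (p - \<kappa> (\<phi> p))) \<in> Q"
        using that preordering_add[OF Q(1)] unfolding bounded_by_def by blast
      moreover have "p + (\<kappa> (- \<phi> p / 2) - (p - \<kappa> (\<phi> p))) = \<kappa> (\<phi> p / 2)"
        using \<kappa>_add[of "- \<phi> p / 2" "\<phi> p"] by (simp add: algebra_simps)
      ultimately show False
        using neg_const[of "\<phi> p / 2"] \<open>\<not> \<phi> p \<ge> 0\<close> by simp
    qed
  qed
qed

text \<open>The abstract Positivstellensatz: an archimedean preordering without \<open>-1\<close> is nonnegative at
  some real character. For coordinate rings the characters are the points of affine space.\<close>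

corollary archimedean_preordering_character:
  assumes T: "preordering T" "-1 \<notin> T" and arch: "\<And>p. \<exists>M. bounded_by T M p"
  obtains \<phi> :: "'a \<Rightarrow> real" where "\<And>p q. \<phi> (p + q) = \<phi> p + \<phi> q" "\<And>p q. \<phi> (p * q) = \<phi> p * \<phi> q"
    "\<And>c. \<phi> (\<kappa> c) = c" "\<And>p. p \<in> T \<Longrightarrow> \<phi> p \<ge> 0"
proof -
  obtain Q where Q: "T \<subseteq> Q" "preordering Q" "-1 \<notin> Q" "\<And>a. a \<in> Q \<or> -a \<in> Q"
    using preordering_extends_to_total[OF T] by blast
  have "\<exists>M. bounded_by Q M p" for p
    using arch[of p] Q(1) unfolding bounded_by_def by blast
  then obtain \<phi> :: "'a \<Rightarrow> real" where "\<And>p q. \<phi> (p + q) = \<phi> p + \<phi> q"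
    "\<And>p q. \<phi> (p * q) = \<phi> p * \<phi> q" "\<And>c. \<phi> (\<kappa> c) = c" "\<And>p. p \<in> Q \<Longrightarrow> \<phi> p \<ge> 0"
    using total_archimedean_character[OF Q(2-4)] by blast
  with that Q(1) show thesis by blast
qed

end

section \<open>Polynomials as functions\<close>

abbreviation mconst :: "real \<Rightarrow> 'n mpoly" where
  "mconst \<equiv> Poly_Mapping.single 0"

definition mvar :: "'n \<Rightarrow> 'n mpoly" where
  "mvar i = Poly_Mapping.single (Poly_Mapping.single i 1) 1"

interpretation const: ring_over_reals "mconst :: real \<Rightarrow> 'n mpoly"
  by unfold_locales (simp_all add: single_add mult_single)

lemma mpoly_monomial_induct [case_names zero add]:
  assumes "P 0" "\<And>\<alpha> c p. P p \<Longrightarrow> P (Poly_Mapping.single \<alpha> c + p)"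
  shows "P (p :: 'n mpoly)"
proof (induction p rule: update_induct)
  case (update f a b)
  have "Poly_Mapping.update a b f = Poly_Mapping.single a b + f"
    using update(1)
    by (intro poly_mapping_eqI) (auto simp: lookup_update lookup_add lookup_single when_def in_keys_iff)
  then show ?case
    using assms(2)[OF update(3)] by simp
qed (rule assms(1))

text \<open>Constants and variables generate the polynomial ring, so properties closed under sums and
  products need only be checked on them.\<close>

lemma monomial_eq_prod_vars:
  "Poly_Mapping.single (\<alpha> :: 'n::finite \<Rightarrow>\<^sub>0 nat) c =
     mconst c * (\<Prod>i\<in>UNIV. mvar i ^ Poly_Mapping.lookup \<alpha> i)"
proof -
  have pow: "mvar i ^ k = Poly_Mapping.single (Poly_Mapping.single i k) 1" for i :: 'n and k
    by (induction k) (simp_all add: mvar_def mult_single flip: single_add)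
  have "(\<Prod>i\<in>A. mvar i ^ Poly_Mapping.lookup \<alpha> i) =
      Poly_Mapping.single (\<Sum>i\<in>A. Poly_Mapping.single i (Poly_Mapping.lookup \<alpha> i)) 1"
    if "finite A" for A :: "'n set"
    using that by induction (simp_all add: pow mult_single)
  moreover have "(\<Sum>i\<in>UNIV. Poly_Mapping.single i (Poly_Mapping.lookup \<alpha> i)) = \<alpha>"
    by (intro poly_mapping_eqI) (simp add: lookup_sum lookup_single when_def)
  ultimately show ?thesis
    by (simp add: mult_single)
qed

lemma mpoly_eval_zero [simp]: "mpoly_eval 0 x = 0"
  by (simp add: mpoly_eval_def)

lemma mpoly_eval_add [simp]: "mpoly_eval (p + q) x = mpoly_eval p x + mpoly_eval q x"
  unfolding mpoly_eval_def by (rule setsum_keys_plus_distrib) (simp_all add: algebra_simps)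

lemma mpoly_eval_monomial:
  "mpoly_eval (Poly_Mapping.single \<alpha> c) x = c * (\<Prod>i\<in>UNIV. (x $ i) ^ Poly_Mapping.lookup \<alpha> i)"
  by (simp add: mpoly_eval_def)

lemma mpoly_eval_const [simp]: "mpoly_eval (mconst c) x = c"
  by (simp add: mpoly_eval_monomial)

lemma mpoly_eval_one [simp]: "mpoly_eval 1 x = 1"
  using mpoly_eval_const[of 1 x] by simp

lemma mpoly_eval_mult [simp]: "mpoly_eval (p * q) x = mpoly_eval p x * mpoly_eval q x"
proof (induction p rule: mpoly_monomial_induct)
  case (add \<alpha> c p)
  have "mpoly_eval (Poly_Mapping.single \<alpha> c * q) x =
      mpoly_eval (Poly_Mapping.single \<alpha> c) x * mpoly_eval q x"
    by (induction q rule: mpoly_monomial_induct)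
      (simp_all add: distrib_left mult_single mpoly_eval_monomial lookup_add power_add prod.distrib)
  with add show ?case
    by (simp add: distrib_right)
qed simp

lemma mpoly_eval_minus [simp]: "mpoly_eval (- p) x = - mpoly_eval p x"
  using mpoly_eval_add[of p "- p" x] by simp

lemma mpoly_eval_power [simp]: "mpoly_eval (p ^ k) x = mpoly_eval p x ^ k"
  by (induction k) simp_all

lemma mpoly_eval_sum [simp]: "mpoly_eval (sum p A) x = (\<Sum>a\<in>A. mpoly_eval (p a) x)"
  by (induction A rule: infinite_finite_induct) simp_all

lemma mpoly_eval_prod [simp]: "mpoly_eval (prod p A) x = (\<Prod>a\<in>A. mpoly_eval (p a) x)"
  by (induction A rule: infinite_finite_induct) simp_all

text \<open>Homomorphisms to the reals that fix constants are evaluations, at the point whose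
  coordinates are the images of the variables.\<close>

lemma character_is_evaluation:
  fixes \<phi> :: "'n::finite mpoly \<Rightarrow> real"
  assumes add: "\<And>p q. \<phi> (p + q) = \<phi> p + \<phi> q" and mult: "\<And>p q. \<phi> (p * q) = \<phi> p * \<phi> q"
    and const: "\<And>c. \<phi> (mconst c) = c"
  shows "\<phi> p = mpoly_eval p (\<chi> i. \<phi> (mvar i))"
proof (induction p rule: mpoly_monomial_induct)
  case zero
  show ?case using add[of 0 0] by simp
next
  case (add \<alpha> c p)
  have one: "\<phi> 1 = 1" using const[of 1] by simp
  have pow: "\<phi> (q ^ k) = \<phi> q ^ k" for q k
    by (induction k) (simp_all add: one mult)
  have "\<phi> (\<Prod>i\<in>A. q i) = (\<Prod>i\<in>A. \<phi> (q i))" if "finite A" for q and A :: "'n set"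
    using that by induction (simp_all add: one mult)
  then have "\<phi> (Poly_Mapping.single \<alpha> c) = mpoly_eval (Poly_Mapping.single \<alpha> c) (\<chi> i. \<phi> (mvar i))"
    unfolding mpoly_eval_monomial by (simp add: monomial_eq_prod_vars[of \<alpha> c] mult const pow)
  with add show ?case by (simp add: assms(1))
qed

section \<open>A Positivstellensatz on balls\<close>

definition sq_norm :: "'n::finite mpoly" where
  "sq_norm = (\<Sum>i\<in>UNIV. (mvar i)\<^sup>2)"

text \<open>Membership of \<open>\<rho> - \<parallel>x\<parallel>\<^sup>2\<close> bounds each variable, hence every polynomial, because bounded
  elements are closed under sums and products.\<close>

lemma ball_preordering_archimedean:
  fixes T :: "'n::finite mpoly set"
  assumes T: "preordering T" and ball: "mconst \<rho> - sq_norm \<in> T"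
  shows "\<exists>M. const.bounded_by T M p"
proof -
  have var: "const.bounded_by T ((\<rho> + 1) / 2) (mvar i)" for i
  proof (rule const.bounded_by_if_square_le[OF T])
    have "mconst \<rho> - (mvar i)\<^sup>2 = (mconst \<rho> - sq_norm) + (\<Sum>j\<in>UNIV - {i}. (mvar j)\<^sup>2)"
      by (simp add: sq_norm_def sum.remove[of UNIV i])
    also have "\<dots> \<in> T"
      by (intro preordering_add[OF T] preordering_sum[OF T] preordering_square[OF T] ball)
    finally show "mconst \<rho> - (mvar i)\<^sup>2 \<in> T" .
  qed
  have const: "\<exists>M. const.bounded_by T M (mconst c)" for c
    using const.bounded_by_const[OF T] by blast
  have mult: "\<exists>M. const.bounded_by T M (p * q)"
    if "\<exists>M. const.bounded_by T M p" "\<exists>M. const.bounded_by T M q" for p q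
    using that const.bounded_by_mult[OF T] by blast
  have pow: "\<exists>M. const.bounded_by T M (mvar i ^ k)" for i k
    using var const[of 1] by (induction k) (auto intro: mult)
  have prod: "\<exists>M. const.bounded_by T M (\<Prod>i\<in>A. mvar i ^ k i)" if "finite A" for A k
    using that const[of 1] by induction (auto intro: mult pow)
  show ?thesis
  proof (induction p rule: mpoly_monomial_induct)
    case zero
    show ?case using const[of 0] by simp
  next
    case (add \<alpha> c p)
    have "\<exists>M. const.bounded_by T M (Poly_Mapping.single \<alpha> c)"
      unfolding monomial_eq_prod_vars[of \<alpha> c] by (intro mult const prod) simp
    with add show ?case
      using const.bounded_by_add[OF T] by blast
  qed
qed

text \<open>Positivstellensatz for compact sets: a preordering that contains the ball polynomial and has
  no point of nonnegativity contains \<open>-1\<close>, since otherwise the character of the abstract version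
  would be such a point.\<close>

lemma ball_positivstellensatz:
  fixes T :: "'n::finite mpoly set"
  assumes T: "preordering T" and ball: "mconst \<rho> - sq_norm \<in> T"
    and empty: "\<And>x. \<exists>p\<in>T. mpoly_eval p x < 0"
  shows "-1 \<in> T"
proof (rule ccontr)
  assume "-1 \<notin> T"
  then obtain \<phi> :: "'n mpoly \<Rightarrow> real" where \<phi>: "\<And>p q. \<phi> (p + q) = \<phi> p + \<phi> q"
    "\<And>p q. \<phi> (p * q) = \<phi> p * \<phi> q" "\<And>c. \<phi> (mconst c) = c" and pos: "\<And>p. p \<in> T \<Longrightarrow> \<phi> p \<ge> 0"
    using const.archimedean_preordering_character[OF T _ ball_preordering_archimedean[OF T ball]]
    by blast
  obtain p where "p \<in> T" "mpoly_eval p (\<chi> i. \<phi> (mvar i)) < 0"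
    using empty by blast
  then show False
    using pos[of p] character_is_evaluation[OF \<phi>, of p] by simp
qed

section \<open>The cone and the ideal of a system\<close>

lemma preordering_sos: "preordering (sos :: 'n::finite mpoly set)"
proof -
  have add_square: "p + a\<^sup>2 \<in> sos" if p: "p \<in> sos" for p a :: "'n mpoly"
  proof -
    obtain m :: nat and q where "p = (\<Sum>j<m. (q j)\<^sup>2)"
      using p unfolding sos_def by blast
    then have "p + a\<^sup>2 = (\<Sum>j<Suc m. ((q(m := a)) j)\<^sup>2)"
      by simp
    then show ?thesis unfolding sos_def by blast
  qed
  have zero: "(0 :: 'n mpoly) \<in> sos"
    unfolding sos_def by (auto intro!: exI[of _ "0::nat"])
  have add: "p + (\<Sum>j<m. (q j)\<^sup>2) \<in> sos" if "p \<in> sos" for p :: "'n mpoly" and q and m :: nat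
    using that by (induction m) (simp_all add: add_square flip: add.assoc)
  have sum: "(\<Sum>j<m. p j) \<in> sos" if p: "\<And>j. p j \<in> sos" for p :: "nat \<Rightarrow> 'n mpoly" and m
  proof (induction m)
    case (Suc m)
    obtain m' :: nat and q where "p m = (\<Sum>j<m'. (q j)\<^sup>2)"
      using p[of m] unfolding sos_def by blast
    with add[OF Suc] show ?case by simp
  qed (simp add: zero)
  show ?thesis
    unfolding preordering_def
  proof (intro conjI ballI allI)
    fix a :: "'n mpoly" show "a\<^sup>2 \<in> sos"
      using add_square[OF zero, of a] by simp
  next
    fix a b :: "'n mpoly" assume ab: "a \<in> sos" "b \<in> sos"
    then obtain m m' :: nat and q q' where a: "a = (\<Sum>j<m. (q j)\<^sup>2)" and b: "b = (\<Sum>j<m'. (q' j)\<^sup>2)"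
      unfolding sos_def by auto
    show "a + b \<in> sos"
      using add[OF ab(1)] by (simp add: b)
    have "a * b = (\<Sum>i<m. \<Sum>j<m'. (q i * q' j)\<^sup>2)"
      by (simp add: a b sum_product power_mult_distrib)
    also have "\<dots> \<in> sos"
      by (intro sum) (use add_square[OF zero] in simp)
    finally show "a * b \<in> sos" .
  qed
qed

lemma gen_cone_0: "gen_cone 0 f = sos"
proof -
  have "gen_cone 0 f = {s {} | s :: nat set \<Rightarrow> 'a mpoly. s {} \<in> sos}"
    by (simp add: gen_cone_def)
  also have "\<dots> = sos"
  proof (intro equalityI subsetI)
    fix p :: "'a mpoly" assume "p \<in> sos"
    then show "p \<in> {s {} | s :: nat set \<Rightarrow> 'a mpoly. s {} \<in> sos}"
      by (intro CollectI exI[of _ "\<lambda>_. p"]) simp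
  qed blast
  finally show ?thesis .
qed

text \<open>The subsets of \<open>{1..Suc k}\<close> split into those that omit \<open>Suc k\<close> and those that contain it, so
  the cone arises by adjoining one generator at a time.\<close>

lemma gen_cone_Suc: "gen_cone (Suc k) f = adjoin (f (Suc k)) (gen_cone k f)"
proof -
  let ?P = "Pow {1..k}"
  have Pow: "Pow {1..Suc k} = ?P \<union> insert (Suc k) ` ?P"
    by (simp add: atLeastAtMostSuc_conv Pow_insert)
  have disj: "?P \<inter> insert (Suc k) ` ?P = {}"
    by auto
  have inj: "inj_on (insert (Suc k)) ?P"
    unfolding inj_on_def by (metis Pow_iff atLeastAtMost_iff insert_ident not_less_eq_eq order_refl subsetD)
  have prod: "(\<Prod>i\<in>insert (Suc k) I. f i) = f (Suc k) * (\<Prod>i\<in>I. f i)" if "I \<in> ?P" for I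
  proof (rule prod.insert)
    show "finite I" using that finite_subset by blast
    show "Suc k \<notin> I" using that by auto
  qed
  have split: "(\<Sum>I\<in>Pow {1..Suc k}. s I * (\<Prod>i\<in>I. f i)) =
      (\<Sum>I\<in>?P. s I * (\<Prod>i\<in>I. f i)) + f (Suc k) * (\<Sum>I\<in>?P. s (insert (Suc k) I) * (\<Prod>i\<in>I. f i))"
    for s :: "nat set \<Rightarrow> 'a mpoly"
  proof -
    have "(\<Sum>I\<in>Pow {1..Suc k}. s I * (\<Prod>i\<in>I. f i)) = (\<Sum>I\<in>?P. s I * (\<Prod>i\<in>I. f i)) +
        (\<Sum>I\<in>insert (Suc k) ` ?P. s I * (\<Prod>i\<in>I. f i))"
      unfolding Pow by (intro sum.union_disjoint disj) simp_all
    also have "(\<Sum>I\<in>insert (Suc k) ` ?P. s I * (\<Prod>i\<in>I. f i)) =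
        (\<Sum>I\<in>?P. s (insert (Suc k) I) * (\<Prod>i\<in>insert (Suc k) I. f i))"
      by (simp only: sum.reindex[OF inj] o_def)
    also have "\<dots> = (\<Sum>I\<in>?P. f (Suc k) * (s (insert (Suc k) I) * (\<Prod>i\<in>I. f i)))"
      by (intro sum.cong refl) (simp only: prod mult.left_commute)
    finally show ?thesis
      by (simp only: sum_distrib_left)
  qed
  show ?thesis
  proof (intro equalityI subsetI)
    fix p assume "p \<in> gen_cone (Suc k) f"
    then obtain s where s: "\<And>I. I \<in> Pow {1..Suc k} \<Longrightarrow> s I \<in> sos"
      and p: "p = (\<Sum>I\<in>Pow {1..Suc k}. s I * (\<Prod>i\<in>I. f i))"
      unfolding gen_cone_def by blast
    have "(\<Sum>I\<in>?P. s I * (\<Prod>i\<in>I. f i)) \<in> gen_cone k f"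
      unfolding gen_cone_def using s Pow by blast
    moreover have "(\<Sum>I\<in>?P. s (insert (Suc k) I) * (\<Prod>i\<in>I. f i)) \<in> gen_cone k f"
      unfolding gen_cone_def using s Pow by (intro CollectI exI[of _ "\<lambda>I. s (insert (Suc k) I)"]) blast
    ultimately show "p \<in> adjoin (f (Suc k)) (gen_cone k f)"
      unfolding p split by (rule adjoinI)
  next
    fix p assume "p \<in> adjoin (f (Suc k)) (gen_cone k f)"
    then obtain s t where s: "\<And>I. I \<in> ?P \<Longrightarrow> s I \<in> sos" and t: "\<And>I. I \<in> ?P \<Longrightarrow> t I \<in> sos"
      and p: "p = (\<Sum>I\<in>?P. s I * (\<Prod>i\<in>I. f i)) + f (Suc k) * (\<Sum>I\<in>?P. t I * (\<Prod>i\<in>I. f i))"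
      unfolding adjoin_def gen_cone_def by blast
    define u where "u I = (if Suc k \<in> I then t (I - {Suc k}) else s I)" for I
    have us: "u I = s I" "u (insert (Suc k) I) = t I" if "I \<in> ?P" for I
    proof -
      have "Suc k \<notin> I" using that by auto
      then show "u I = s I" "u (insert (Suc k) I) = t I" by (simp_all add: u_def)
    qed
    have "p = (\<Sum>I\<in>Pow {1..Suc k}. u I * (\<Prod>i\<in>I. f i))"
    proof -
      have "(\<Sum>I\<in>?P. u I * (\<Prod>i\<in>I. f i)) = (\<Sum>I\<in>?P. s I * (\<Prod>i\<in>I. f i))"
        "(\<Sum>I\<in>?P. u (insert (Suc k) I) * (\<Prod>i\<in>I. f i)) = (\<Sum>I\<in>?P. t I * (\<Prod>i\<in>I. f i))"
        by (intro sum.cong refl, simp only: us)+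
      then show ?thesis
        unfolding split p by (simp only:)
    qed
    moreover have "u I \<in> sos" if "I \<in> Pow {1..Suc k}" for I
      using that s t us unfolding Pow by auto
    ultimately show "p \<in> gen_cone (Suc k) f"
      unfolding gen_cone_def by blast
  qed
qed

lemma preordering_gen_cone: "preordering (gen_cone k f)"
  by (induction k) (simp_all add: gen_cone_0 gen_cone_Suc preordering_sos preordering_adjoin)

lemma generator_in_gen_cone: "i \<in> {1..k} \<Longrightarrow> f i \<in> gen_cone k f"
proof (induction k)
  case (Suc k)
  show ?case
  proof (cases "i = Suc k")
    case True
    then show ?thesis by (simp add: gen_cone_Suc generator_in_adjoin preordering_gen_cone)
  next
    case False
    then show ?thesis
      using Suc subset_adjoin[OF preordering_gen_cone] by (auto simp: gen_cone_Suc)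
  qed
qed simp

lemma gen_ideal_zero: "0 \<in> gen_ideal l g"
  unfolding gen_ideal_def by (auto intro!: exI[of _ "\<lambda>_. 0"])

lemma gen_ideal_add:
  assumes "p \<in> gen_ideal l g" "q \<in> gen_ideal l g"
  shows "p + q \<in> gen_ideal l g"
proof -
  obtain t u where "p = (\<Sum>j\<in>{1..l}. t j * g j)" "q = (\<Sum>j\<in>{1..l}. u j * g j)"
    using assms unfolding gen_ideal_def by blast
  then have "p + q = (\<Sum>j\<in>{1..l}. (t j + u j) * g j)"
    by (simp only: sum.distrib distrib_right)
  then show ?thesis
    unfolding gen_ideal_def by (intro CollectI exI[of _ "\<lambda>j. t j + u j"]) simp
qed

lemma gen_ideal_mult:
  assumes "p \<in> gen_ideal l g"
  shows "q * p \<in> gen_ideal l g"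
proof -
  obtain t where "p = (\<Sum>j\<in>{1..l}. t j * g j)"
    using assms unfolding gen_ideal_def by blast
  then have "q * p = (\<Sum>j\<in>{1..l}. (q * t j) * g j)"
    by (simp only: sum_distrib_left mult.assoc)
  then show ?thesis
    unfolding gen_ideal_def by (intro CollectI exI[of _ "\<lambda>j. q * t j"]) simp
qed

lemma generator_in_gen_ideal: "j \<in> {1..l} \<Longrightarrow> g j \<in> gen_ideal l g"
proof -
  assume j: "j \<in> {1..l}"
  have "(\<Sum>i\<in>{1..l}. (if i = j then 1 else 0) * g i) = (\<Sum>i\<in>{1..l}. if i = j then g i else 0)"
    by (intro sum.cong) auto
  also have "\<dots> = g j" using j by simp
  finally show ?thesis
    unfolding gen_ideal_def by (intro CollectI exI[of _ "\<lambda>i. if i = j then 1 else 0"]) simp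
qed

lemma mpoly_eval_gen_cone_nonneg:
  assumes "p \<in> gen_cone k f" "x \<in> nonneg_set k f"
  shows "mpoly_eval p x \<ge> 0"
proof -
  obtain s where s: "\<And>I. I \<in> Pow {1..k} \<Longrightarrow> s I \<in> sos"
    and p: "p = (\<Sum>I\<in>Pow {1..k}. s I * (\<Prod>i\<in>I. f i))"
    using assms(1) unfolding gen_cone_def by blast
  have "mpoly_eval (s I) x \<ge> 0" if "I \<in> Pow {1..k}" for I
    using s[OF that] by (auto simp: sos_def intro!: sum_nonneg)
  moreover have "mpoly_eval (f i) x \<ge> 0" if "i \<in> {1..k}" for i
    using assms(2) that by (auto simp: nonneg_set_def)
  ultimately show ?thesis
    unfolding p by (auto intro!: sum_nonneg mult_nonneg_nonneg prod_nonneg)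
qed

lemma mpoly_eval_gen_ideal_zero:
  assumes "q \<in> gen_ideal l g" "x \<in> zero_set l g"
  shows "mpoly_eval q x = 0"
proof -
  obtain t where "q = (\<Sum>j\<in>{1..l}. t j * g j)"
    using assms(1) unfolding gen_ideal_def by blast
  moreover have "mpoly_eval (g j) x = 0" if "j \<in> {1..l}" for j
    using assms(2) that unfolding zero_set_def by blast
  ultimately show ?thesis by simp
qed

lemma mpoly_eval_certificate_ge_one:
  assumes "h \<in> one_plus_cone_ideal k f l g" "x \<in> nonneg_set k f \<inter> zero_set l g"
  shows "mpoly_eval h x \<ge> 1"
proof -
  obtain p q where "h = 1 + p + q" "p \<in> gen_cone k f" "q \<in> gen_ideal l g"
    using assms(1) unfolding one_plus_cone_ideal_def by blast
  then show ?thesis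
    using mpoly_eval_gen_cone_nonneg[of p k f x] mpoly_eval_gen_ideal_zero[of q l g x] assms(2)
    by simp
qed

text \<open>The preordering generated by the \<open>f\<^sub>i\<close>, the ball polynomial and the ideal has no point of
  nonnegativity: at any \<open>x\<close> either some \<open>f\<^sub>i\<close> is negative, or one of \<open>g\<^sub>j\<close> and \<open>-g\<^sub>j\<close> is. Since
  the system has no solution at all, \<open>\<rho>\<close> can be prescribed freely.\<close>

lemma empty_system_ball_certificate:
  assumes empty: "nonneg_set k f \<inter> zero_set l g = {}"
  obtains a b q where "a \<in> gen_cone k f" "b \<in> gen_cone k f" "q \<in> gen_ideal l g"
    "-1 = a + (mconst \<rho> - sq_norm) * b + q"
proof -
  let ?u = "mconst \<rho> - sq_norm :: 'a mpoly"
  let ?C = "adjoin ?u (gen_cone k f)"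
  define T where "T = {s + j | s j. s \<in> ?C \<and> j \<in> gen_ideal l g}"
  have C: "preordering ?C"
    by (intro preordering_adjoin preordering_gen_cone)
  have T: "preordering T"
    unfolding T_def by (intro preordering_plus_ideal C gen_ideal_zero gen_ideal_add gen_ideal_mult)
  have CT: "?C \<subseteq> T"
    unfolding T_def using gen_ideal_zero by force
  have IT: "gen_ideal l g \<subseteq> T"
    unfolding T_def using preordering_zero[OF C] by force
  have "\<exists>p\<in>T. mpoly_eval p x < 0" for x
  proof (cases "x \<in> nonneg_set k f")
    case False
    then obtain i where "i \<in> {1..k}" "mpoly_eval (f i) x < 0"
      by (auto simp: nonneg_set_def not_le)
    then show ?thesis
      using CT subset_adjoin[OF preordering_gen_cone] generator_in_gen_cone by blast
  next
    case True
    then have "x \<notin> zero_set l g"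
      using empty by blast
    then obtain j where j: "j \<in> {1..l}" "mpoly_eval (g j) x \<noteq> 0"
      by (auto simp: zero_set_def)
    have "g j \<in> T" "- g j \<in> T"
      using IT generator_in_gen_ideal[OF j(1)] gen_ideal_mult[of "g j" l g "-1"] by auto
    moreover have "mpoly_eval (g j) x < 0 \<or> mpoly_eval (- g j) x < 0"
      using j by auto
    ultimately show ?thesis by blast
  qed
  then have "-1 \<in> T"
    using CT generator_in_adjoin[OF preordering_gen_cone]
    by (intro ball_positivstellensatz[OF T, of \<rho>]) blast+
  then obtain c q where "-1 = c + q" "c \<in> ?C" and q: "q \<in> gen_ideal l g"
    unfolding T_def by blast
  moreover from \<open>c \<in> ?C\<close> obtain a b where "c = a + ?u * b" "a \<in> gen_cone k f" "b \<in> gen_cone k f"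
    unfolding adjoin_def by blast
  ultimately show thesis
    using that[of a b q] by simp
qed

section \<open>Degrees and coefficients\<close>

definition exp_degree :: "('n::finite \<Rightarrow>\<^sub>0 nat) \<Rightarrow> nat" where
  "exp_degree \<alpha> = (\<Sum>i\<in>UNIV. Poly_Mapping.lookup \<alpha> i)"

lemma exp_degree_add: "exp_degree (\<alpha> + \<beta>) = exp_degree \<alpha> + exp_degree \<beta>"
  by (simp add: exp_degree_def lookup_add sum.distrib)

lemma exp_degree_eq_0: "exp_degree \<alpha> = 0 \<longleftrightarrow> \<alpha> = 0"
  by (auto simp: exp_degree_def intro: poly_mapping_eqI)

lemma mpoly_degree_le_iff:
  "mpoly_degree p \<le> d \<longleftrightarrow> (\<forall>\<alpha>\<in>Poly_Mapping.keys p. exp_degree \<alpha> \<le> d)"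
  by (simp add: mpoly_degree_def exp_degree_def)

lemma mpoly_degree_const [simp]: "mpoly_degree (mconst c) = 0"
  by (simp add: mpoly_degree_def)

lemma mpoly_degree_mult: "mpoly_degree (p * q) \<le> mpoly_degree p + mpoly_degree q"
proof -
  have "exp_degree (\<alpha> + \<beta>) \<le> mpoly_degree p + mpoly_degree q"
    if "\<alpha> \<in> Poly_Mapping.keys p" "\<beta> \<in> Poly_Mapping.keys q" for \<alpha> \<beta>
    using that mpoly_degree_le_iff[of p "mpoly_degree p"] mpoly_degree_le_iff[of q "mpoly_degree q"]
    by (simp add: exp_degree_add add_mono)
  then show ?thesis
    unfolding mpoly_degree_le_iff using keys_mult[of p q] by blast
qed

lemma mpoly_degree_power: "mpoly_degree (p ^ k) \<le> k * mpoly_degree p"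
proof (induction k)
  case 0
  show ?case using mpoly_degree_const[of 1] by (simp del: mpoly_degree_const)
next
  case (Suc k)
  then show ?case
    using mpoly_degree_mult[of p "p ^ k"] by simp
qed

text \<open>The sum of the absolute values of the coefficients dominates the largest one and, unlike it,
  is submultiplicative.\<close>

definition coeff_norm :: "'n::finite mpoly \<Rightarrow> real" where
  "coeff_norm p = (\<Sum>\<alpha>\<in>Poly_Mapping.keys p. \<bar>Poly_Mapping.lookup p \<alpha>\<bar>)"

lemma coeff_norm_nonneg: "coeff_norm p \<ge> 0"
  by (simp add: coeff_norm_def sum_nonneg)

lemma coeff_norm_monomial [simp]: "coeff_norm (Poly_Mapping.single \<alpha> c) = \<bar>c\<bar>"
  by (simp add: coeff_norm_def)

lemma coeff_norm_zero [simp]: "coeff_norm 0 = 0"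
  by (simp add: coeff_norm_def)

lemma coeff_norm_one [simp]: "coeff_norm 1 = 1"
  by (simp add: coeff_norm_def)

lemma coeff_norm_add: "coeff_norm (p + q) \<le> coeff_norm p + coeff_norm q"
proof -
  let ?A = "Poly_Mapping.keys p \<union> Poly_Mapping.keys q"
  have norm: "coeff_norm r = (\<Sum>\<alpha>\<in>?A. \<bar>Poly_Mapping.lookup r \<alpha>\<bar>)" if "Poly_Mapping.keys r \<subseteq> ?A" for r
    unfolding coeff_norm_def using that by (intro sum.mono_neutral_left) (auto simp: in_keys_iff)
  have "coeff_norm (p + q) \<le> (\<Sum>\<alpha>\<in>?A. \<bar>Poly_Mapping.lookup p \<alpha>\<bar> + \<bar>Poly_Mapping.lookup q \<alpha>\<bar>)"
    using keys_add[of p q] by (subst norm) (auto simp: lookup_add intro!: sum_mono abs_triangle_ineq)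
  also have "\<dots> = coeff_norm p + coeff_norm q"
    by (simp add: sum.distrib norm)
  finally show ?thesis .
qed

lemma coeff_norm_sum: "coeff_norm (sum p A) \<le> (\<Sum>a\<in>A. coeff_norm (p a))"
  by (induction A rule: infinite_finite_induct)
    (auto intro: order_trans[OF coeff_norm_add])

lemma mpoly_eq_sum_monomials:
  "(p :: 'n mpoly) = (\<Sum>\<alpha>\<in>Poly_Mapping.keys p. Poly_Mapping.single \<alpha> (Poly_Mapping.lookup p \<alpha>))"
  by (intro poly_mapping_eqI) (simp add: lookup_sum lookup_single when_def in_keys_iff)

lemma coeff_norm_mult: "coeff_norm (p * q) \<le> coeff_norm p * coeff_norm q"
proof -
  let ?m = "\<lambda>p \<alpha>. Poly_Mapping.single \<alpha> (Poly_Mapping.lookup p \<alpha>) :: 'a mpoly"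
  have "p * q = (\<Sum>\<alpha>\<in>Poly_Mapping.keys p. \<Sum>\<beta>\<in>Poly_Mapping.keys q. ?m p \<alpha> * ?m q \<beta>)"
    by (subst (1) mpoly_eq_sum_monomials[of p], subst (1) mpoly_eq_sum_monomials[of q])
      (rule sum_product)
  also have "coeff_norm \<dots> \<le>
      (\<Sum>\<alpha>\<in>Poly_Mapping.keys p. \<Sum>\<beta>\<in>Poly_Mapping.keys q. coeff_norm (?m p \<alpha> * ?m q \<beta>))"
    by (intro coeff_norm_sum order_trans[OF coeff_norm_sum sum_mono])
  also have "\<dots> = coeff_norm p * coeff_norm q"
    by (simp add: mult_single abs_mult coeff_norm_def[of p] coeff_norm_def[of q] sum_product)
  finally show ?thesis .
qed

lemma coeff_norm_power: "coeff_norm (p ^ k) \<le> coeff_norm p ^ k"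
proof (induction k)
  case 0
  show ?case by simp
next
  case (Suc k)
  show ?case
    using coeff_norm_mult[of p "p ^ k"] mult_left_mono[OF Suc coeff_norm_nonneg[of p]] by simp
qed

lemma coeff_norm_sq_norm: "coeff_norm (sq_norm :: 'n::finite mpoly) \<le> CARD('n)"
proof -
  have "coeff_norm ((mvar i)\<^sup>2) = 1" for i :: 'n
    by (simp add: mvar_def power2_eq_square mult_single)
  then show ?thesis
    using coeff_norm_sum[of "\<lambda>i::'n. (mvar i)\<^sup>2" UNIV] by (simp add: sq_norm_def)
qed

lemma mpoly_degree_sq_norm: "mpoly_degree sq_norm \<le> 2"
proof -
  have "\<alpha> \<in> (\<Union>i. Poly_Mapping.keys ((mvar i)\<^sup>2))" if "\<alpha> \<in> Poly_Mapping.keys sq_norm" for \<alpha> :: "'a \<Rightarrow>\<^sub>0 nat"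
    using that Poly_Mapping.keys_sum unfolding sq_norm_def by fast
  then show ?thesis
    by (force simp: mpoly_degree_le_iff mvar_def power2_eq_square mult_single exp_degree_def
        lookup_add lookup_single when_def sum.distrib)
qed

lemma finite_range_abs_lookup: "finite (range (\<lambda>\<alpha>. \<bar>Poly_Mapping.lookup p \<alpha>\<bar> :: real))"
proof (rule finite_subset)
  show "range (\<lambda>\<alpha>. \<bar>Poly_Mapping.lookup p \<alpha>\<bar>) \<subseteq>
      insert 0 ((\<lambda>\<alpha>. \<bar>Poly_Mapping.lookup p \<alpha>\<bar>) ` Poly_Mapping.keys p)"
    by (auto simp: in_keys_iff)
qed simp

lemma abs_lookup_le_max_abs_coeff: "\<bar>Poly_Mapping.lookup p \<alpha>\<bar> \<le> max_abs_coeff p"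
  unfolding max_abs_coeff_def by (intro Max_ge finite_range_abs_lookup) simp

lemma max_abs_coeff_le_coeff_norm: "max_abs_coeff p \<le> coeff_norm p"
proof -
  have "\<bar>Poly_Mapping.lookup p \<alpha>\<bar> \<le> coeff_norm p" for \<alpha>
  proof (cases "\<alpha> \<in> Poly_Mapping.keys p")
    case True
    then show ?thesis unfolding coeff_norm_def by (intro member_le_sum) auto
  next
    case False
    then show ?thesis by (simp add: in_keys_iff coeff_norm_nonneg)
  qed
  then show ?thesis
    unfolding max_abs_coeff_def by (subst Max_le_iff) (auto simp: finite_range_abs_lookup)
qed

text \<open>Exponent vectors of degree \<open>m\<close> are the multiplicity functions of multisets of size \<open>m\<close>.\<close>

lemma card_exp_degree_eq:
  fixes m :: nat
  shows "finite {\<alpha> :: 'n::finite \<Rightarrow>\<^sub>0 nat. exp_degree \<alpha> = m}" (is "finite ?E")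
    and "card {\<alpha> :: 'n \<Rightarrow>\<^sub>0 nat. exp_degree \<alpha> = m} \<le> (CARD('n) + m - 1) choose m"
proof -
  define F :: "('n \<Rightarrow>\<^sub>0 nat) \<Rightarrow> 'n multiset"
    where "F \<alpha> = (\<Sum>i\<in>UNIV. replicate_mset (Poly_Mapping.lookup \<alpha> i) i)" for \<alpha>
  have "count (F \<alpha>) i = Poly_Mapping.lookup \<alpha> i" for \<alpha> i
    by (simp add: F_def count_sum if_distrib cong: if_cong)
  then have inj: "inj_on F ?E"
    by (intro inj_onI poly_mapping_eqI) metis
  have "F ` ?E \<subseteq> multisets_of_size UNIV m"
    by (auto simp: multisets_of_size_def F_def exp_degree_def)
  note F = inj this
  have fin: "finite (multisets_of_size (UNIV :: 'n set) m)"
    by (rule finite_multisets_of_size) simp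
  show "finite ?E"
    using F fin by (metis finite_imageD finite_subset)
  show "card ?E \<le> (CARD('n) + m - 1) choose m"
    using card_inj_on_le[OF F fin] by (simp add: card_multisets_of_size)
qed

text \<open>The inverse of this number is the coefficient bound of the theorem. The sum counts each monomial
  of degree at most \<open>d\<close> with its largest value on the cube of half-width \<open>r\<close>.\<close>

definition monomial_bound :: "'n::finite itself \<Rightarrow> nat \<Rightarrow> real \<Rightarrow> real" where
  "monomial_bound _ d r = (\<Sum>m=0..d. real ((CARD('n) + m - 1) choose m) * r ^ m)"

lemma abs_mpoly_eval_le:
  fixes p :: "'n::finite mpoly"
  assumes "infnorm x \<le> s"
  shows "\<bar>mpoly_eval p x\<bar> \<le> max_abs_coeff p * monomial_bound TYPE('n) (mpoly_degree p) s"
proof -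
  let ?M = "max_abs_coeff p" and ?d = "mpoly_degree p"
  let ?mon = "\<lambda>\<alpha>. \<Prod>i\<in>UNIV. (x $ i) ^ Poly_Mapping.lookup \<alpha> i"
  let ?E = "\<lambda>m. {\<alpha> :: 'n \<Rightarrow>\<^sub>0 nat. exp_degree \<alpha> = m}"
  have s: "s \<ge> 0" using assms infnorm_pos_le[of x] by linarith
  have M: "?M \<ge> 0" using abs_lookup_le_max_abs_coeff[of p 0] by linarith
  have mon: "\<bar>?mon \<alpha>\<bar> \<le> s ^ exp_degree \<alpha>" for \<alpha>
  proof -
    have "\<bar>?mon \<alpha>\<bar> = (\<Prod>i\<in>UNIV. \<bar>x $ i\<bar> ^ Poly_Mapping.lookup \<alpha> i)"
      by (simp add: abs_prod power_abs)
    also have "\<dots> \<le> (\<Prod>i\<in>UNIV. s ^ Poly_Mapping.lookup \<alpha> i)"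
      using component_le_infnorm_cart[of x] assms by (intro prod_mono conjI power_mono) (auto intro: order_trans)
    finally show ?thesis by (simp add: exp_degree_def power_sum)
  qed
  have "\<bar>mpoly_eval p x\<bar> \<le> (\<Sum>\<alpha>\<in>Poly_Mapping.keys p. ?M * s ^ exp_degree \<alpha>)"
    unfolding mpoly_eval_def
    by (intro order_trans[OF sum_abs] sum_mono)
      (auto simp: abs_mult intro!: mult_mono abs_lookup_le_max_abs_coeff mon M)
  also have "\<dots> \<le> (\<Sum>\<alpha>\<in>(\<Union>m\<in>{0..?d}. ?E m). ?M * s ^ exp_degree \<alpha>)"
    using mpoly_degree_le_iff[of p ?d] M s by (intro sum_mono2) (auto intro!: card_exp_degree_eq(1))
  also have "\<dots> = (\<Sum>m=0..?d. \<Sum>\<alpha>\<in>?E m. ?M * s ^ exp_degree \<alpha>)"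
    by (intro sum.UNION_disjoint) (auto intro: card_exp_degree_eq(1))
  also have "\<dots> = ?M * (\<Sum>m=0..?d. real (card (?E m)) * s ^ m)"
    by (simp add: sum_distrib_left mult_ac)
  also have "\<dots> \<le> ?M * monomial_bound TYPE('n) ?d s"
    unfolding monomial_bound_def using card_exp_degree_eq(2)[where 'n = 'n] s M
    by (intro mult_left_mono sum_mono mult_right_mono) auto
  finally show ?thesis .
qed

text \<open>Strictness comes from the linear monomials, which is why the degree must be positive.\<close>

lemma monomial_bound_strict_mono:
  assumes "0 \<le> s" "s < r" "d \<ge> 1"
  shows "monomial_bound TYPE('n::finite) d s < monomial_bound TYPE('n) d r"
  unfolding monomial_bound_def
proof (rule sum_strict_mono_ex1)
  show "\<forall>m\<in>{0..d}. real ((CARD('n) + m - 1) choose m) * s ^ m \<le> real ((CARD('n) + m - 1) choose m) * r ^ m"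
    using assms by (auto intro!: mult_left_mono power_mono)
  show "\<exists>m\<in>{0..d}. real ((CARD('n) + m - 1) choose m) * s ^ m < real ((CARD('n) + m - 1) choose m) * r ^ m"
    using assms by (intro bexI[of _ 1]) auto
qed simp

lemma monomial_bound_ge_one:
  assumes "r \<ge> 0"
  shows "monomial_bound TYPE('n::finite) d r \<ge> 1"
proof -
  have "(\<Sum>m\<in>{0}. real ((CARD('n) + m - 1) choose m) * r ^ m) \<le> monomial_bound TYPE('n) d r"
    unfolding monomial_bound_def using assms by (intro sum_mono2) auto
  then show ?thesis by simp
qed

lemma monomial_bound_mono_degree:
  assumes "r \<ge> 0" "d \<le> e"
  shows "monomial_bound TYPE('n::finite) d r \<le> monomial_bound TYPE('n) e r"
  unfolding monomial_bound_def using assms by (intro sum_mono2) auto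

text \<open>Any estimate exponential in the degree serves; this one bounds the binomial coefficient by a
  power of two and the geometric sum by the binomial expansion of \<open>(2 r + 1)\<^sup>d\<close>.\<close>

lemma monomial_bound_le_exponential:
  assumes r: "r \<ge> 0"
  shows "monomial_bound TYPE('n::finite) d r \<le> 2 ^ CARD('n) * (2 * r + 1) ^ d"
proof -
  have "monomial_bound TYPE('n) d r \<le> (\<Sum>m=0..d. 2 ^ CARD('n) * (2 * r) ^ m)"
    unfolding monomial_bound_def
  proof (rule sum_mono)
    fix m
    have "real ((CARD('n) + m - 1) choose m) \<le> 2 ^ (CARD('n) + m - 1)"
      using binomial_le_pow2[of "CARD('n) + m - 1" m] by (metis of_nat_le_iff of_nat_numeral of_nat_power)
    also have "\<dots> \<le> 2 ^ (CARD('n) + m)"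
      by (rule power_increasing) auto
    finally have "real ((CARD('n) + m - 1) choose m) * r ^ m \<le> 2 ^ (CARD('n) + m) * r ^ m"
      using r by (intro mult_right_mono) auto
    then show "real ((CARD('n) + m - 1) choose m) * r ^ m \<le> 2 ^ CARD('n) * (2 * r) ^ m"
      by (simp add: power_add power_mult_distrib)
  qed
  also have "\<dots> = 2 ^ CARD('n) * (\<Sum>m=0..d. (2 * r) ^ m)"
    by (simp add: sum_distrib_left)
  also have "(\<Sum>m=0..d. (2 * r) ^ m) \<le> (2 * r + 1) ^ d"
  proof (induction d)
    case (Suc d)
    have "(2 * r) ^ Suc d \<le> 2 * r * (2 * r + 1) ^ d"
      using r power_mono[of "2 * r" "2 * r + 1" d] by (simp add: mult_left_mono)
    with Suc show ?case by (simp add: algebra_simps)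
  qed simp
  finally show ?thesis by simp
qed

section \<open>Small certificates\<close>

lemma small_certificate_imp_empty:
  fixes h :: "'n::finite mpoly"
  assumes r: "r > 0" and box: "\<forall>x \<in> nonneg_set k f \<inter> zero_set l g. infnorm x < r"
    and h: "h \<in> one_plus_cone_ideal k f l g" "h \<noteq> 1"
    and small: "max_abs_coeff h \<le> inverse (monomial_bound TYPE('n) (mpoly_degree h) r)"
  shows "nonneg_set k f \<inter> zero_set l g = {}"
proof (rule ccontr)
  let ?B = "monomial_bound TYPE('n) (mpoly_degree h)"
  assume "\<not> ?thesis"
  then obtain x where x: "x \<in> nonneg_set k f \<inter> zero_set l g" by blast
  have ge1: "mpoly_eval h x \<ge> 1"
    by (rule mpoly_eval_certificate_ge_one[OF h(1) x])
  also have "mpoly_eval h x \<le> max_abs_coeff h * ?B (infnorm x)"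
    using abs_mpoly_eval_le[OF order_refl, of h x] by linarith
  finally have le: "1 \<le> max_abs_coeff h * ?B (infnorm x)" .
  have B1: "?B r \<ge> 1" using monomial_bound_ge_one[of r] r by simp
  then have small': "max_abs_coeff h * ?B r \<le> 1"
    using small by (simp add: field_simps)
  \<comment> \<open>In degree 0 the bound is 1, which leaves 1 as the only constant with a value of at least 1.\<close>
  show False
  proof (cases "mpoly_degree h = 0")
    case True
    have "Poly_Mapping.lookup h \<alpha> = 0" if "\<alpha> \<noteq> 0" for \<alpha>
      using that mpoly_degree_le_iff[of h 0] True by (auto simp: exp_degree_eq_0 in_keys_iff)
    then have hc: "h = mconst (Poly_Mapping.lookup h 0)"
      by (intro poly_mapping_eqI) (auto simp: lookup_single when_def)
    have "mpoly_eval h x = Poly_Mapping.lookup h 0"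
      by (subst hc) simp
    moreover have "max_abs_coeff h \<le> 1"
      using small B1 by (meson inverse_le_1_iff order_trans)
    ultimately have "Poly_Mapping.lookup h 0 = 1"
      using ge1 abs_lookup_le_max_abs_coeff[of h 0] by linarith
    with hc h(2) show False by simp
  next
    case False
    have "max_abs_coeff h \<noteq> 0"
      using le by auto
    then have "max_abs_coeff h > 0"
      using abs_lookup_le_max_abs_coeff[of h 0] by linarith
    then have "max_abs_coeff h * ?B (infnorm x) < max_abs_coeff h * ?B r"
      using monomial_bound_strict_mono[of "infnorm x" r "mpoly_degree h"] box x False
      by (simp add: infnorm_pos_le)
    with le small' show False by linarith
  qed
qed

lemma one_minus_times_one_minus_power:
  fixes y :: "'a::comm_ring_1"
  shows "(1 - y) * (1 - y ^ k) = (1 - y)\<^sup>2 * (\<Sum>j<k. y ^ j)"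
  using one_diff_power_eq[of y k] by (simp add: power2_eq_square mult.assoc)

text \<open>Certificates of the form \<open>y\<^sup>m D\<close> with \<open>D\<close> independent of \<open>m\<close>. They arise by replacing the
  multiplier \<open>1 - y\<close> in the certificate of emptiness, which need not lie in the cone, by
  \<open>(1 - y) (1 - y\<^sup>m)\<close>, which does.\<close>

lemma empty_imp_certificate_family:
  fixes f g :: "nat \<Rightarrow> 'n::finite mpoly"
  assumes empty: "nonneg_set k f \<inter> zero_set l g = {}" and \<rho>: "\<rho> > 0"
  obtains D where "\<And>m. (mconst (1 / \<rho>) * sq_norm) ^ m * D \<in> one_plus_cone_ideal k f l g"
proof -
  let ?C = "gen_cone k f"
  note C = preordering_gen_cone[of k f]
  obtain a b q where m: "a \<in> ?C" "b \<in> ?C" "q \<in> gen_ideal l g"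
    and eq: "-1 = a + (mconst \<rho> - sq_norm) * b + q"
    using empty_system_ball_certificate[OF empty] by blast
  define y :: "'n mpoly" where "y = mconst (1 / \<rho>) * sq_norm"
  have c1: "mconst (1 / \<rho>) * mconst \<rho> = (1 :: 'n mpoly)"
    using \<rho> by (simp add: mult_single)
  have sub: "mconst \<rho> - sq_norm = mconst \<rho> * (1 - y)"
    using c1 by (simp add: y_def algebra_simps flip: mult.assoc)
  define b' where "b' = mconst \<rho> * b"
  have b': "b' \<in> ?C"
    unfolding b'_def using \<rho> by (intro preordering_mult[OF C] const.nonneg_const_in_preordering[OF C] m) simp
  have eq': "-1 = a + (1 - y) * b' + q"
    using eq unfolding sub b'_def by (simp add: algebra_simps)
  have y: "y \<in> ?C"
    unfolding y_def sq_norm_def using \<rho>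
    by (intro preordering_mult[OF C] const.nonneg_const_in_preordering[OF C] preordering_sum[OF C]
        preordering_square[OF C]) simp
  have "y ^ m * ((y - 1) * b') \<in> one_plus_cone_ideal k f l g" for m
  proof -
    have "(1 - y) * (1 - y ^ m) \<in> ?C"
      unfolding one_minus_times_one_minus_power
      by (intro preordering_mult[OF C] preordering_square[OF C] preordering_sum[OF C]
          preordering_power[OF C] y)
    then have "a + (1 - y) * (1 - y ^ m) * b' \<in> ?C"
      by (rule preordering_add[OF C m(1) preordering_mult[OF C _ b']])
    moreover have "y ^ m * ((y - 1) * b') = 1 + (a + (1 - y) * (1 - y ^ m) * b') + q"
    proof -
      have "1 + (a + (1 - y) * (1 - y ^ m) * b') + q
          = 1 + (a + (1 - y) * b' + q) + y ^ m * ((y - 1) * b')"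
        by (simp add: algebra_simps)
      also have "\<dots> = y ^ m * ((y - 1) * b')"
        unfolding eq'[symmetric] by simp
      finally show ?thesis ..
    qed
    ultimately show ?thesis
      unfolding one_plus_cone_ideal_def using m(3) by blast
  qed
  then show thesis
    using that unfolding y_def by blast
qed

text \<open>Raising \<open>m\<close> by one multiplies the coefficient norm of \<open>y\<^sup>m D\<close> by at most \<open>n / \<rho>\<close> and raises
  the degree by at most 2, hence the exponential estimate of the monomial bound by at most
  \<open>(2 r + 1)\<^sup>2\<close>. The choice of \<open>\<rho>\<close> makes the product of these two factors equal to 1/2.\<close>

lemma power_multiple_small:
  fixes D :: "'n::finite mpoly" and r \<rho> :: real
  assumes r: "r > 0" and \<rho>: "\<rho> = 2 * CARD('n) * (2 * r + 1)\<^sup>2"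
  obtains m where "let h = (mconst (1 / \<rho>) * sq_norm) ^ m * D in
    coeff_norm h * monomial_bound TYPE('n) (mpoly_degree h) r < 1"
proof -
  let ?y = "mconst (1 / \<rho>) * sq_norm :: 'n mpoly" and ?n = "real CARD('n)" and ?s = "2 * r + 1"
  have \<rho>_pos: "\<rho> > 0" using r by (simp add: \<rho>)
  define K where "K = coeff_norm D * (2 ^ CARD('n) * ?s ^ mpoly_degree D)"
  have K: "K \<ge> 0" using r by (simp add: K_def coeff_norm_nonneg)
  have norm_y: "coeff_norm ?y \<le> ?n / \<rho>"
  proof -
    have "coeff_norm ?y \<le> 1 / \<rho> * coeff_norm (sq_norm :: 'n mpoly)"
      using coeff_norm_mult[of "mconst (1 / \<rho>)" "sq_norm :: 'n mpoly"] \<rho>_pos by simp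
    also have "\<dots> \<le> 1 / \<rho> * ?n"
      using coeff_norm_sq_norm[where 'n = 'n] \<rho>_pos by (intro mult_left_mono) auto
    finally show ?thesis by simp
  qed
  have deg_y: "mpoly_degree ?y \<le> 2"
    using mpoly_degree_mult[of "mconst (1 / \<rho>)" "sq_norm :: 'n mpoly"]
      mpoly_degree_sq_norm[where 'a = 'n]
    by simp
  have bound: "coeff_norm (?y ^ m * D) * monomial_bound TYPE('n) (mpoly_degree (?y ^ m * D)) r
      \<le> K * (1 / 2) ^ m" for m
  proof -
    have "coeff_norm (?y ^ m * D) \<le> (?n / \<rho>) ^ m * coeff_norm D"
      using coeff_norm_mult[of "?y ^ m" D] coeff_norm_power[of ?y m]
        power_mono[OF norm_y coeff_norm_nonneg, of m]
      by (meson coeff_norm_nonneg mult_right_mono order_trans)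
    moreover have "mpoly_degree (?y ^ m * D) \<le> 2 * m + mpoly_degree D"
      using mpoly_degree_mult[of "?y ^ m" D] mpoly_degree_power[of ?y m] mult_le_mono2[OF deg_y, of m]
      by linarith
    then have "monomial_bound TYPE('n) (mpoly_degree (?y ^ m * D)) r \<le>
        2 ^ CARD('n) * ?s ^ (2 * m + mpoly_degree D)"
      using monomial_bound_mono_degree[of r] monomial_bound_le_exponential[of r] r
      by (meson less_imp_le order_trans)
    ultimately have "coeff_norm (?y ^ m * D) * monomial_bound TYPE('n) (mpoly_degree (?y ^ m * D)) r
      \<le> (?n / \<rho>) ^ m * coeff_norm D * (2 ^ CARD('n) * ?s ^ (2 * m + mpoly_degree D))"
      using monomial_bound_ge_one[of r, where 'n = 'n] r \<rho>_pos
      by (intro mult_mono) (auto intro: order_trans[of 0 1] simp: coeff_norm_nonneg)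
    also have "\<dots> = K * (?n / \<rho> * ?s\<^sup>2) ^ m"
      unfolding power_add power_mult K_def by (simp only: power_mult_distrib mult_ac)
    also have "?n / \<rho> * ?s\<^sup>2 = 1 / 2"
      using r by (simp add: \<rho>)
    finally show ?thesis .
  qed
  have "(\<lambda>m. K * (1 / 2) ^ m) \<longlonglongrightarrow> K * 0"
    by (intro tendsto_mult tendsto_const LIMSEQ_power_zero) simp
  then have "eventually (\<lambda>m. K * (1 / 2) ^ m < 1) sequentially"
    by (rule order_tendstoD) simp
  then obtain m where "K * (1 / 2) ^ m < 1"
    by (auto simp: eventually_sequentially)
  with bound[of m] that[of m] show thesis
    by (simp add: Let_def)
qed

text \<open>The strict inequality from the preceding lemma also excludes \<open>h = 1\<close>, whose coefficient norm
  times the monomial bound is at least 1.\<close>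

lemma empty_imp_small_certificate:
  fixes f g :: "nat \<Rightarrow> 'n::finite mpoly"
  assumes empty: "nonneg_set k f \<inter> zero_set l g = {}" and r: "r > 0"
  obtains h where "h \<in> one_plus_cone_ideal k f l g" "h \<noteq> 1"
    "max_abs_coeff h \<le> inverse (monomial_bound TYPE('n) (mpoly_degree h) r)"
proof -
  define \<rho> where "\<rho> = 2 * CARD('n) * (2 * r + 1)\<^sup>2"
  have "\<rho> > 0" using r by (simp add: \<rho>_def)
  then obtain D where D: "\<And>m. (mconst (1 / \<rho>) * sq_norm) ^ m * D \<in> one_plus_cone_ideal k f l g"
    using empty_imp_certificate_family[OF empty] by blast
  obtain m where m: "let h = (mconst (1 / \<rho>) * sq_norm) ^ m * D in
    coeff_norm h * monomial_bound TYPE('n) (mpoly_degree h) r < 1"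
    using power_multiple_small[OF r \<rho>_def] by blast
  define h where "h = (mconst (1 / \<rho>) * sq_norm) ^ m * D"
  have lt: "coeff_norm h * monomial_bound TYPE('n) (mpoly_degree h) r < 1"
    using m unfolding h_def Let_def .
  have B: "monomial_bound TYPE('n) (mpoly_degree h) r \<ge> 1"
    using monomial_bound_ge_one r by (metis less_imp_le)
  show thesis
  proof (rule that)
    show "h \<in> one_plus_cone_ideal k f l g"
      unfolding h_def by (rule D)
    show "h \<noteq> 1"
      using lt B by auto
    have "coeff_norm h \<le> inverse (monomial_bound TYPE('n) (mpoly_degree h) r)"
      using lt B by (simp add: field_simps)
    then show "max_abs_coeff h \<le> inverse (monomial_bound TYPE('n) (mpoly_degree h) r)"
      using max_abs_coeff_le_coeff_norm[of h] by linarith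
  qed
qed

theorem lemma6:
  fixes f g :: "nat \<Rightarrow> 'n::finite mpoly" and k l :: nat and r :: real
  assumes "r > 0"
    and "\<forall>x \<in> nonneg_set k f \<inter> zero_set l g. infnorm x < r"
  shows "nonneg_set k f \<inter> zero_set l g = {} \<longleftrightarrow>
    (\<exists>h \<in> one_plus_cone_ideal k f l g.
       h \<noteq> 1 \<and>
       max_abs_coeff h \<le> inverse (\<Sum>m=0..mpoly_degree h. real ((CARD('n) + m - 1) choose m) * r ^ m))"
    (is "_ \<longleftrightarrow> ?R")
proof
  assume "nonneg_set k f \<inter> zero_set l g = {}"
  then obtain h where "h \<in> one_plus_cone_ideal k f l g" "h \<noteq> 1"
    "max_abs_coeff h \<le> inverse (monomial_bound TYPE('n) (mpoly_degree h) r)"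
    using empty_imp_small_certificate[OF _ assms(1)] by blast
  then show ?R
    unfolding monomial_bound_def by (intro bexI[of _ h] conjI)
next
  assume ?R
  then obtain h where "h \<in> one_plus_cone_ideal k f l g" "h \<noteq> 1"
    "max_abs_coeff h \<le> inverse (monomial_bound TYPE('n) (mpoly_degree h) r)"
    unfolding monomial_bound_def by (elim bexE conjE)
  then show "nonneg_set k f \<inter> zero_set l g = {}"
    by (rule small_certificate_imp_empty[OF assms])
qed

end
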